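(* Let $R\in\mathbb{Z}[X]$ be a non-zero polynomial of magnitude bounded by $(N,\Lambda)$ and $F\in\mathbb{Z}[X,Y]$ be of magnitude bounded by $(n_1,\tau_1)$, and suppose that $$V_{\mathbb{C}}(R,F)=\{(x,y)\in\mathbb{C}^2\mid R(x)=F(x,y)=0\}$$ is finite. Let $G_1,\dots,G_m$ in $\mathbb{C}[X,Y]$ be polynomials of magnitude bounded by $(n_2,\tau_2)$. Write $\mu(x)=\mathrm{mul}(x,R)$ and, for $(x,y)\in V_{\mathbb{C}}(R,F)$, $\nu(y)=\mathrm{mul}(y,F(x,Y))$. (a) Suppose that $A\subset V_{\mathbb{C}}(R,F)$ and that, for every $(x,y)\in A$, $i(x,y)\in\{1,\dots,m\}$ is such that $G_{i(x,y)}(x,y)\ne0$. Then $$\sum_{(x,y)\in A}\mu(x)\,\nu(y)\log(|G_{i(x,y)}(x,y)|)\in\tilde O\big((\tau_2n_1+\tau_1n_2)N+(\Lambda+N)n_1n_2\big).$$ (b) Suppose that $G_1,\dots,G_m\in\mathbb{Z}[X,Y]$ and that for every $(x,y)\in V_{\mathbb{C}}(R,F)$ there exists $i$ such that $G_i(x,y)\ne0$. Denoting by $i(x,y)$ the smallest value of $i$ such that $G_i(x,y)\ne0$, we have $$\sum_{(x,y)\in V_{\mathbb{C}}(R,F)}\mu(x)\,\nu(y)\,\big|\log(|G_{i(x,y)}(x,y)|)\big|\in\tilde O\big((\tau_2n_1+\tau_1n_2)N+(\Lambda+N)n_1n_2\big).$$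
   Context: A univariate (resp. bivariate) polynomial is of magnitude bounded by $(n,\tau)$ if its degree (resp. total degree) is at most $n$ and each coefficient has bitsize at most $\tau$, i.e. absolute value at most $2^\tau$ (for complex coefficients: absolute value at most $2^\tau$). $\mathrm{mul}(x,f)$ is the multiplicity of $x$ as a root of the univariate polynomial $f$. "$s\in\tilde O(g)$" for a real quantity $s$ is an upper bound: $s\le C\,g\cdot(\text{polylogarithmic factor in the parameters }N,\Lambda,n_1,\tau_1,n_2,\tau_2)$ with $C$ an absolute constant; the parameters are positive integers. *)

theory Defs
  imports Complex_Main "HOL-Computational_Algebra.Polynomial"
begin

text \<open>
  A bivariate polynomial \<open>F(X,Y)\<close> is represented as a polynomial in \<open>Y\<close> with coefficients in
  the polynomials in \<open>X\<close>: the coefficient of \<open>X^i Y^j\<close> is \<open>coeff (coeff F j) i\<close>.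
\<close>

definition total_degree :: "'a::zero poly poly \<Rightarrow> nat" where
  "total_degree F = Max (insert 0 {i + j | i j. coeff (coeff F j) i \<noteq> 0})"

abbreviation complex_poly :: "int poly \<Rightarrow> complex poly" where
  "complex_poly \<equiv> map_poly of_int"

abbreviation complex_poly2 :: "int poly poly \<Rightarrow> complex poly poly" where
  "complex_poly2 \<equiv> map_poly complex_poly"

text \<open>\<open>spec_X F x\<close> is the univariate polynomial \<open>F(x,Y)\<close>.\<close>

definition spec_X :: "complex poly poly \<Rightarrow> complex \<Rightarrow> complex poly" where
  "spec_X F x = map_poly (\<lambda>c. poly c x) F"

definition eval2 :: "complex poly poly \<Rightarrow> complex \<Rightarrow> complex \<Rightarrow> complex" where
  "eval2 F x y = poly (spec_X F x) y"

definition magnitude :: "complex poly \<Rightarrow> nat \<Rightarrow> nat \<Rightarrow> bool" where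
  "magnitude f n \<tau> \<longleftrightarrow> degree f \<le> n \<and> (\<forall>i. cmod (coeff f i) \<le> 2 ^ \<tau>)"

definition magnitude2 :: "complex poly poly \<Rightarrow> nat \<Rightarrow> nat \<Rightarrow> bool" where
  "magnitude2 F n \<tau> \<longleftrightarrow>
     total_degree F \<le> n \<and> (\<forall>i j. cmod (coeff (coeff F j) i) \<le> 2 ^ \<tau>)"

definition zeros :: "int poly \<Rightarrow> int poly poly \<Rightarrow> (complex \<times> complex) set" where
  "zeros R F = {(x, y). poly (complex_poly R) x = 0 \<and> eval2 (complex_poly2 F) x y = 0}"

text \<open>
  Upper bounds up to polylogarithmic factors: \<open>s\<close> is in soft-O of \<open>g\<close>, for positive integer
  parameters \<open>ps\<close>, if \<open>s \<le> soft_bound C k ps g\<close> with \<open>C\<close> and \<open>k\<close> absolute constants. The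
  summand 2 keeps the logarithm positive. Up to constants, any polynomial in the logarithms of
  the parameters is dominated by such a power.
\<close>

definition soft_bound :: "real \<Rightarrow> nat \<Rightarrow> nat list \<Rightarrow> real \<Rightarrow> real" where
  "soft_bound C k ps g = C * g * ln (2 + real (sum_list ps)) ^ k"

lemma finite_support_poly2: "finite {i + j | i j. coeff (coeff F j) i \<noteq> 0}"
proof -
  have "{i + j | i j. coeff (coeff F j) i \<noteq> 0} \<subseteq>
        (\<Union>j\<in>{..degree F}. (\<lambda>i. i + j) ` {..degree (coeff F j)})"
    by (auto simp: image_iff) (metis atMost_iff coeff_0 le_degree)
  then show ?thesis
    by (rule finite_subset) auto
qed

lemma total_degree_le_iff:
  "total_degree F \<le> n \<longleftrightarrow> (\<forall>i j. coeff (coeff F j) i \<noteq> 0 \<longrightarrow> i + j \<le> n)"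
  unfolding total_degree_def using finite_support_poly2[of F] by (subst Max_le_iff) auto

end

theory Submission
  imports Defs "Jordan_Normal_Form.Determinant" "Berlekamp_Zassenhaus.Mahler_Measure"
begin

text \<open>
  Upper bounds. For a polynomial \<open>G\<close> of magnitude \<open>(n2, \<tau>2)\<close> the triangle inequality gives
  \<open>ln \<bar>G(x,y)\<bar> \<le> 2 ln (n2 + 1) + \<tau>2 + n2 ln\<^sup>+ \<bar>x\<bar> + n2 ln\<^sup>+ \<bar>y\<bar>\<close>, so it suffices to bound the weighted
  sums of \<open>ln\<^sup>+ \<bar>x\<bar>\<close> and \<open>ln\<^sup>+ \<bar>y\<bar>\<close> over all zeros. Landau's inequality bounds the Mahler measure of
  \<open>R\<close>, hence \<open>\<Sum> \<mu>(x) ln\<^sup>+ \<bar>x\<bar>\<close>. Applied to \<open>F(x, Y)\<close> it bounds \<open>\<Sum> \<nu>(y) ln\<^sup>+ \<bar>y\<bar> + ln \<bar>lc(F(x, Y))\<bar>\<close>,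
  so a lower bound for \<open>\<Sum> \<mu>(x) ln \<bar>lc(F(x, Y))\<bar>\<close> is needed as well.

  Lower bounds. They hold on average because a non-zero integer has absolute value at least 1.
  If \<open>S\<close> is a polynomial in \<open>X\<close> of degree at most \<open>K\<close>, with coefficients in \<open>\<int>[T]\<close>, then
  \<open>lc(R)^K \<Prod>\<^sub>x S(x, T)\<close>, over the roots of \<open>R\<close> with multiplicity, is up to sign a resultant and hence
  lies in \<open>\<int>[T]\<close>. If it does not vanish, its leading coefficient in \<open>T\<close> is a non-zero integer and also
  the product of \<open>lc(R)^K\<close> and the leading coefficients of the \<open>S(x, T)\<close>
  (\<open>lead_coeff_product_ge_1\<close>). The variable \<open>T\<close> handles quantities that are selected by a condition
  at each point. With \<open>S = F(X, T)\<close> the leading coefficient of \<open>S(x, T)\<close> is that of \<open>F(x, Y)\<close>, although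
  the degree of \<open>F(x, Y)\<close> depends on \<open>x\<close> (\<open>lead_coeff_spec_X_product_ge_1\<close>). With \<open>S\<close> the resultant
  with respect to \<open>Y\<close> of \<open>F\<close> and \<open>Y^(n2+1) + \<Sum>\<^sub>l T^(m+1-l) G\<^sub>l\<close>, the leading coefficient of \<open>S(x, T)\<close> is, up
  to sign, a power of \<open>lc(F(x, Y))\<close> times the product over \<open>y\<close> of the first non-vanishing values among
  the \<open>G\<^sub>l(x, y)\<close> (\<open>value_product_ge_1\<close>). Taking logarithms yields both lower bounds.

  Both steps rest on the product formula for resultants with prescribed formal degrees
  (\<open>formal_resultant_roots\<close>). The estimates give the theorem with one logarithmic factor and the
  constants 5 and 17.
\<close>

hide_const (open) Coset.order UnivPoly.up_ring.coeff UnivPoly.up_ring.monom Module.smult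

section \<open>Resultants with formal degrees\<close>

definition coeff_mat :: "nat \<Rightarrow> (nat \<Rightarrow> 'a::zero poly) \<Rightarrow> 'a mat" where
  "coeff_mat k r = mat k k (\<lambda>(i, j). coeff (r i) j)"

text \<open>
  The rows of the Sylvester matrix, \<open>p, Y p, \<dots>, Y^(n-1) p, q, Y q, \<dots>, Y^(m-1) q\<close>, with the
  coefficients of each row in ascending order. The numbers \<open>n\<close> and \<open>m\<close> are formal degrees of \<open>q\<close>
  and \<open>p\<close>: below, \<open>p\<close> and \<open>q\<close> are specialised at points where the degree of \<open>p\<close> may drop, and
  the determinant has to commute with that.
\<close>

definition sylvester_rows :: "nat \<Rightarrow> 'a::comm_ring_1 poly \<Rightarrow> 'a poly \<Rightarrow> nat \<Rightarrow> 'a poly" where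
  "sylvester_rows n p q i = (if i < n then monom 1 i * p else monom 1 (i - n) * q)"

definition formal_resultant :: "nat \<Rightarrow> nat \<Rightarrow> 'a::comm_ring_1 poly \<Rightarrow> 'a poly \<Rightarrow> 'a" where
  "formal_resultant n m p q = det (coeff_mat (n + m) (sylvester_rows n p q))"

lemma coeff_mat_carrier [simp]: "coeff_mat k r \<in> carrier_mat k k"
  by (simp add: coeff_mat_def)

lemma coeff_mat_index [simp]: "i < k \<Longrightarrow> j < k \<Longrightarrow> coeff_mat k r $$ (i, j) = coeff (r i) j"
  by (simp add: coeff_mat_def)

lemma coeff_mat_dim [simp]: "dim_row (coeff_mat k r) = k" "dim_col (coeff_mat k r) = k"
  by (simp_all add: coeff_mat_def)

lemma coeff_mat_cong: "(\<And>i. i < k \<Longrightarrow> r i = r' i) \<Longrightarrow> coeff_mat k r = coeff_mat k r'"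
  by (auto simp: coeff_mat_def)

lemma mult_mat_entry:
  assumes "A \<in> carrier_mat k k" "B \<in> carrier_mat k k" "i < k" "j < k"
  shows "(A * B) $$ (i, j) = (\<Sum>l<k. A $$ (i, l) * B $$ (l, j))"
  using assms by (simp add: scalar_prod_def atLeast0LessThan)

lemma det_unit_lower_triangular:
  assumes "A \<in> carrier_mat k k"
    and "\<And>i j. i < j \<Longrightarrow> j < k \<Longrightarrow> A $$ (i, j) = 0" and "\<And>i. i < k \<Longrightarrow> A $$ (i, i) = (1 :: 'a :: comm_ring_1)"
  shows "det A = 1"
  by (subst det_lower_triangular[OF assms(2,1)]) (use assms in \<open>auto simp: prod_list_diag_prod\<close>)

lemma det_coeff_mat_subtract_previous_rows:
  fixes r :: "nat \<Rightarrow> 'a :: comm_ring_1 poly"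
  shows "det (coeff_mat k (\<lambda>i. if n < i then r i - smult a (r (i - 1)) else r i)) = det (coeff_mat k r)"
    (is "det ?M' = det ?M")
proof -
  define W :: "'a mat" where
    "W = mat k k (\<lambda>(i, j). if j = i then 1 else if n < i \<and> j = i - 1 then - a else 0)"
  have W: "W \<in> carrier_mat k k" by (simp add: W_def)
  have "?M' = W * ?M"
  proof (rule eq_matI)
    fix i j assume "i < dim_row (W * ?M)" "j < dim_col (W * ?M)"
    hence ij: "i < k" "j < k" using W by auto
    have "(W * ?M) $$ (i, j) = (\<Sum>l<k. W $$ (i, l) * coeff (r l) j)"
      using ij by (subst mult_mat_entry[OF W coeff_mat_carrier]) auto
    also have "\<dots> = (\<Sum>l<k. (if l = i then coeff (r i) j else 0) +
        (if l = i - 1 then (if n < i then - a * coeff (r (i - 1)) j else 0) else 0))"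
      using ij by (intro sum.cong) (auto simp: W_def)
    also have "\<dots> = ?M' $$ (i, j)"
      using ij less_imp_diff_less[of i k 1] by (simp add: sum.distrib sum.delta)
    finally show "?M' $$ (i, j) = (W * ?M) $$ (i, j)" ..
  qed (use W in auto)
  moreover have "det W = 1"
    by (rule det_unit_lower_triangular[OF W]) (auto simp: W_def)
  ultimately show ?thesis by (simp add: det_mult[OF W coeff_mat_carrier])
qed

lemma synthetic_div_linear_mult: "synthetic_div ([:- a, 1:] * s) a = (s :: 'a :: comm_ring_1 poly)"
  using synthetic_div_unique[of "[:- a, 1:] * s" a s 0] by (simp add: algebra_simps)

text \<open>
  Passing from \<open>P\<close> to the pair of its value at \<open>a\<close> and its quotient by \<open>Y - a\<close> is a unimodular
  change of coordinates: its inverse sends the standard basis to \<open>1, Y - a, Y (Y - a), \<dots>\<close>,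
  whose matrix \<open>V\<close> is unit lower triangular.
\<close>

lemma det_coeff_mat_synthetic_div:
  fixes r :: "nat \<Rightarrow> 'a :: comm_ring_1 poly"
  assumes deg: "\<And>i. i < Suc k \<Longrightarrow> degree (r i) \<le> k"
  shows "det (coeff_mat (Suc k) r) =
         det (coeff_mat (Suc k) (\<lambda>i. pCons (poly (r i) a) (synthetic_div (r i) a)))"
    (is "det ?M = det ?N")
proof -
  define v where "v = (\<lambda>i. case i of 0 \<Rightarrow> 1 | Suc l \<Rightarrow> monom 1 l * [:- a, 1:])"
  let ?V = "coeff_mat (Suc k) v"
  have "?M = ?N * ?V"
  proof (rule eq_matI)
    fix i j assume "i < dim_row (?N * ?V)" "j < dim_col (?N * ?V)"
    hence ij: "i < Suc k" "j < Suc k" by auto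
    define s where "s = synthetic_div (r i) a"
    have "s = (\<Sum>l<k. monom (coeff s l) l)"
    proof (cases k)
      case 0
      thus ?thesis using deg[OF ij(1)] by (simp add: s_def synthetic_div_eq_0_iff)
    next
      case (Suc k')
      hence "degree s \<le> k'" using deg[OF ij(1)] by (simp add: s_def degree_synthetic_div)
      from poly_as_sum_of_monoms'[OF this] show ?thesis by (simp add: Suc lessThan_Suc_atMost)
    qed
    hence "r i = [:poly (r i) a:] + (\<Sum>l<k. monom (coeff s l) l) * [:- a, 1:]"
      using synthetic_div_correct'[of a "r i"] by (simp add: s_def mult.commute add.commute)
    also have "\<dots> = smult (poly (r i) a) (v 0) + (\<Sum>l<k. smult (coeff s l) (v (Suc l)))"
      by (simp add: v_def sum_distrib_right smult_monom
               del: mult_pCons_left mult_pCons_right flip: mult_smult_left)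
    finally have "coeff (r i) j = coeff (\<dots>) j" by (rule arg_cong)
    also have "\<dots> = (?N * ?V) $$ (i, j)"
      using ij by (subst mult_mat_entry) (auto simp: sum.lessThan_Suc_shift coeff_sum s_def simp del: sum.lessThan_Suc)
    finally show "?M $$ (i, j) = (?N * ?V) $$ (i, j)" using ij by simp
  qed auto
  moreover have "det ?V = 1"
  proof (rule det_unit_lower_triangular)
    show "?V $$ (i, j) = 0" if "i < j" "j < Suc k" for i j
      using that by (auto simp: v_def coeff_monom_mult coeff_pCons split: nat.splits)
    show "?V $$ (i, i) = 1" if "i < Suc k" for i
      using that by (auto simp: v_def coeff_monom_mult split: nat.splits)
  qed simp
  ultimately show ?thesis by (simp add: det_mult[OF coeff_mat_carrier coeff_mat_carrier])
qed

lemma det_coeff_mat_single_constant_term: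
  fixes s :: "nat \<Rightarrow> 'a :: comm_ring_1 poly"
  assumes n: "n < Suc k" and c: "\<And>i. i < Suc k \<Longrightarrow> i \<noteq> n \<Longrightarrow> c i = 0"
  shows "det (coeff_mat (Suc k) (\<lambda>i. pCons (c i) (s i))) =
         (-1) ^ n * c n * det (coeff_mat k (\<lambda>i. s (if i < n then i else Suc i)))"
proof -
  let ?M = "coeff_mat (Suc k) (\<lambda>i. pCons (c i) (s i))"
  have "det ?M = (\<Sum>i<Suc k. ?M $$ (i, 0) * cofactor ?M i 0)"
    by (rule laplace_expansion_column) auto
  also have "\<dots> = (\<Sum>i<Suc k. if i = n then c n * cofactor ?M n 0 else 0)"
    using c by (intro sum.cong) auto
  also have "\<dots> = c n * cofactor ?M n 0" using n by (simp add: sum.delta del: sum.lessThan_Suc)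
  also have "mat_delete ?M n 0 = coeff_mat k (\<lambda>i. s (if i < n then i else Suc i))"
    by (rule eq_matI) (use n in \<open>auto simp: mat_delete_def\<close>)
  hence "cofactor ?M n 0 = (-1) ^ n * det (coeff_mat k (\<lambda>i. s (if i < n then i else Suc i)))"
    by (simp add: cofactor_def)
  finally show ?thesis by (simp add: mult_ac)
qed

lemma degree_monom_1_mult_le: "degree (monom 1 i * p) \<le> i + degree (p :: 'a :: comm_ring_1 poly)"
  using degree_mult_le[of "monom 1 i" p] degree_monom_le[of "1::'a" i] by linarith

text \<open>
  Subtracting \<open>a\<close> times the preceding row from each of the rows \<open>Y q, Y^2 q, \<dots>\<close> makes every
  row divisible by \<open>Y - a\<close>, except the row \<open>q\<close>. In the coordinates of
  \<open>det_coeff_mat_synthetic_div\<close> the column of values at \<open>a\<close> then has the single entry \<open>q(a)\<close>,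
  and expanding along it leaves the Sylvester matrix of \<open>p\<close> and \<open>q\<close>.
\<close>

lemma formal_resultant_linear_factor:
  fixes p q :: "'a :: comm_ring_1 poly"
  assumes p: "degree p \<le> m" and q: "degree q \<le> n"
  shows "formal_resultant n (Suc m) ([:- a, 1:] * p) q = (-1) ^ n * poly q a * formal_resultant n m p q"
proof -
  let ?r = "sylvester_rows n ([:- a, 1:] * p) q"
  define s where "s i = (if i < n then monom 1 i * p else monom 1 (i - Suc n) * q)" for i
  define t where "t i = (if i = n then q else [:- a, 1:] * s i)" for i
  have "degree ([:- a, 1:] * p) \<le> Suc m"
    using degree_mult_le[of "[:- a, 1:]" p] p by simp
  have dt: "degree (t i) \<le> n + m" if "i < Suc (n + m)" for i
  proof -
    have "degree (s i) < n + m" if "i \<noteq> n"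
      using degree_monom_1_mult_le[of i p] degree_monom_1_mult_le[of "i - Suc n" q] p q \<open>i < Suc (n + m)\<close> that
      by (auto simp: s_def)
    moreover have "degree ([:- a, 1:] * s i) \<le> 1 + degree (s i)"
      using degree_mult_le[of "[:- a, 1:]" "s i"] by simp
    ultimately show ?thesis using q by (fastforce simp: t_def)
  qed
  have "formal_resultant n (Suc m) ([:- a, 1:] * p) q =
        det (coeff_mat (Suc (n + m)) (\<lambda>i. if n < i then ?r i - smult a (?r (i - 1)) else ?r i))"
    by (simp add: formal_resultant_def det_coeff_mat_subtract_previous_rows)
  also have "coeff_mat (Suc (n + m)) (\<lambda>i. if n < i then ?r i - smult a (?r (i - 1)) else ?r i) =
             coeff_mat (Suc (n + m)) t"
  proof (rule coeff_mat_cong)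
    fix i
    consider "i < n" | "i = n" | j where "i = Suc (n + j)"
      by (metis less_imp_Suc_add linorder_neqE_nat)
    thus "(if n < i then ?r i - smult a (?r (i - 1)) else ?r i) = t i"
    proof cases
      case 3
      have "monom 1 (Suc j) = [:0, 1:] * (monom 1 j :: 'a poly)"
        by (simp add: monom_Suc)
      thus ?thesis using 3
        by (simp add: sylvester_rows_def t_def s_def algebra_simps)
    qed (auto simp: sylvester_rows_def t_def s_def algebra_simps)
  qed
  also have "det (coeff_mat (Suc (n + m)) t) =
    det (coeff_mat (Suc (n + m)) (\<lambda>i. pCons (poly (t i) a) (synthetic_div (t i) a)))"
    by (rule det_coeff_mat_synthetic_div[OF dt])
  also have "\<dots> = (-1) ^ n * poly (t n) a *
      det (coeff_mat (n + m) (\<lambda>i. synthetic_div (t (if i < n then i else Suc i)) a))"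
    by (rule det_coeff_mat_single_constant_term) (auto simp: t_def)
  also have "coeff_mat (n + m) (\<lambda>i. synthetic_div (t (if i < n then i else Suc i)) a) =
             coeff_mat (n + m) (sylvester_rows n p q)"
  proof (rule coeff_mat_cong)
    fix i
    have "synthetic_div (t j) a = s j" if "j \<noteq> n" for j
      using that by (simp only: t_def synthetic_div_linear_mult if_False)
    thus "synthetic_div (t (if i < n then i else Suc i)) a = sylvester_rows n p q i"
      by (auto simp: s_def sylvester_rows_def)
  qed
  finally show ?thesis by (simp add: t_def formal_resultant_def)
qed

lemma formal_resultant_const:
  fixes q :: "'a :: comm_ring_1 poly"
  assumes q: "degree q \<le> n"
  shows "formal_resultant n h [:c:] q = c ^ n * coeff q n ^ h"
proof -
  let ?M = "coeff_mat (n + h) (sylvester_rows n [:c:] q)"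
  have "det ?M = prod_list (diag_mat ?M)"
  proof (rule det_lower_triangular)
    fix i j assume "i < j" "j < n + h"
    thus "?M $$ (i, j) = 0"
      using q by (auto simp: sylvester_rows_def coeff_monom_mult intro!: coeff_eq_0)
  qed simp
  also have "\<dots> = (\<Prod>i<n + h. if i < n then c else coeff q n)"
    by (auto simp: prod_list_diag_prod sylvester_rows_def coeff_monom_mult atLeast0LessThan intro!: prod.cong)
  also have "\<dots> = c ^ n * coeff q n ^ h"
  proof (induction h)
    case 0
    have "(\<Prod>i<n. if i < n then c else coeff q n) = (\<Prod>i<n. c)" by (intro prod.cong) auto
    thus ?case by simp
  qed (simp add: mult_ac)
  finally show ?thesis by (simp add: formal_resultant_def)
qed

text \<open>
  The product formula. The degree of the first polynomial may lie \<open>h\<close> below its formal degree;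
  this costs only a power of the formal leading coefficient of \<open>q\<close>, hence nothing at all when
  \<open>q\<close> is monic.
\<close>

lemma formal_resultant_roots:
  fixes q :: "'a :: comm_ring_1 poly"
  assumes q: "degree q \<le> n"
  shows "formal_resultant n (length as + h) (smult c (\<Prod>a\<leftarrow>as. [:- a, 1:])) q =
         (-1) ^ (n * length as) * c ^ n * coeff q n ^ h * (\<Prod>a\<leftarrow>as. poly q a)"
proof (induction as)
  case Nil
  show ?case using formal_resultant_const[OF q] by simp
next
  case (Cons a as)
  have "degree (\<Prod>a\<leftarrow>as. [:- a, 1:]) \<le> length as"
  proof (induction as)
    case (Cons a as)
    show ?case using degree_mult_le[of "[:- a, 1:]" "\<Prod>a\<leftarrow>as. [:- a, 1:]"] Cons by simp
  qed simp
  hence "degree (smult c (\<Prod>a\<leftarrow>as. [:- a, 1:])) \<le> length as + h"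
    by (meson degree_smult_le le_add1 order.trans)
  from formal_resultant_linear_factor[OF this q, of a] Cons.IH
  show ?case by (simp add: power_add mult_ac del: mult_pCons_left)
qed

lemma (in comm_ring_hom) formal_resultant_hom:
  "hom (formal_resultant n m p q) = formal_resultant n m (map_poly hom p) (map_poly hom q)"
proof -
  have "map_mat hom (coeff_mat (n + m) (sylvester_rows n p q)) =
        coeff_mat (n + m) (sylvester_rows n (map_poly hom p) (map_poly hom q))"
    by (rule eq_matI) (auto simp: sylvester_rows_def coeff_monom_mult)
  thus ?thesis by (simp add: formal_resultant_def flip: hom_det)
qed

text \<open>
  Each term of the determinant takes one entry from each of the \<open>n\<close> rows of \<open>p\<close> and one from
  each of the \<open>m\<close> rows of \<open>q\<close>. The two kinds of rows are counted separately because the bound is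
  used with \<open>n = n2 + 1\<close>, \<open>m = a = n1\<close> and \<open>b = n2\<close>, where the result has to be of the order
  \<open>n1 n2\<close>; the maximum over all entries would only give \<open>(n + m) max a b\<close>.
\<close>

lemma degree_formal_resultant_le:
  fixes p q :: "'a :: comm_ring_1 poly poly"
  assumes p: "\<And>j. degree (coeff p j) \<le> a" and q: "\<And>j. degree (coeff q j) \<le> b"
  shows "degree (formal_resultant n m p q) \<le> n * a + m * b"
proof -
  let ?M = "coeff_mat (n + m) (sylvester_rows n p q)"
  have "degree (signof \<pi> * (\<Prod>i = 0..<n + m. ?M $$ (i, \<pi> i))) \<le> n * a + m * b"
    if "\<pi> permutes {0..<n + m}" for \<pi>
  proof -
    have "degree (\<Prod>i = 0..<n + m. ?M $$ (i, \<pi> i)) \<le> (\<Sum>i = 0..<n + m. degree (?M $$ (i, \<pi> i)))"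
      by (rule degree_prod_sum_le[unfolded o_def]) simp
    also have "\<dots> \<le> (\<Sum>i = 0..<n + m. if i < n then a else b)"
    proof (rule sum_mono)
      fix i assume i: "i \<in> {0..<n + m}"
      hence "\<pi> i < n + m" using permutes_in_image[OF that, of i] by simp
      thus "degree (?M $$ (i, \<pi> i)) \<le> (if i < n then a else b)"
        using i p q by (auto simp: sylvester_rows_def coeff_monom_mult)
    qed
    also have "\<dots> = n * a + m * b"
      by (subst sum.atLeastLessThan_concat[of 0 n "n + m", symmetric]) auto
    finally have "degree (\<Prod>i = 0..<n + m. ?M $$ (i, \<pi> i)) \<le> n * a + m * b" .
    thus ?thesis by (simp add: sign_def)
  qed
  thus ?thesis unfolding formal_resultant_def
    by (subst det_def'[OF coeff_mat_carrier]) (intro degree_sum_le finite_permutations, auto)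
qed

section \<open>Sums over the roots of a complex polynomial\<close>

lemma sum_list_singleton_mset: "(\<Sum>a\<leftarrow>xs. {#a#}) = mset xs"
  by (induction xs) auto

lemma mset_complex_roots_complex:
  assumes "p \<noteq> 0"
  shows "mset (complex_roots_complex p) = proots p"
proof -
  have "proots p = proots (smult (lead_coeff p) (\<Prod>a\<leftarrow>complex_roots_complex p. [:- a, 1:]))"
    by (simp only: complex_roots(1))
  also have "\<dots> = (\<Sum>a\<leftarrow>complex_roots_complex p. {#a#})"
    using assms proots_linear_factor[of "- _ :: complex"]
    by (simp add: proots_prod_list[where ps = "map _ _", unfolded list.map_comp o_def list.map_id] image_iff)
  also have "\<dots> = mset (complex_roots_complex p)"
    by (rule sum_list_singleton_mset)
  finally show ?thesis ..
qed

lemma set_complex_roots_complex: "p \<noteq> 0 \<Longrightarrow> set (complex_roots_complex p) = {x. poly p x = 0}"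
  by (metis mset_complex_roots_complex set_count_proots set_mset_mset)

lemma sum_list_complex_roots:
  fixes \<phi> :: "complex \<Rightarrow> real"
  assumes "p \<noteq> 0"
  shows "(\<Sum>x\<leftarrow>complex_roots_complex p. \<phi> x) = (\<Sum>x | poly p x = 0. real (order x p) * \<phi> x)"
proof -
  have "(\<Sum>x\<leftarrow>xs. \<phi> x) = (\<Sum>x\<in>set xs. real (count (mset xs) x) * \<phi> x)" for xs
  proof (induction xs)
    case (Cons a xs)
    have "(\<Sum>x\<in>set (a # xs). real (count (mset (a # xs)) x) * \<phi> x) =
      (\<Sum>x\<in>set (a # xs). (if x = a then \<phi> x else 0) + real (count (mset xs) x) * \<phi> x)"
      by (intro sum.cong) (auto simp: algebra_simps)
    also have "\<dots> = \<phi> a + (\<Sum>x\<in>set (a # xs). real (count (mset xs) x) * \<phi> x)"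
      by (simp add: sum.distrib sum.delta del: set_simps) simp
    also have "(\<Sum>x\<in>set (a # xs). real (count (mset xs) x) * \<phi> x) =
               (\<Sum>x\<in>set xs. real (count (mset xs) x) * \<phi> x)"
      by (intro sum.mono_neutral_right) (auto simp: count_eq_zero_iff)
    finally show ?case using Cons by simp
  qed simp
  from this[of "complex_roots_complex p"] show ?thesis
    using assms by (simp add: mset_complex_roots_complex set_complex_roots_complex)
qed

section \<open>Products over roots that are integers\<close>

text \<open>
  An element of \<open>\<int>[T][X]\<close> is a polynomial in \<open>X\<close> over \<open>\<int>[T]\<close>; substituting the number \<open>x\<close> for \<open>X\<close>
  gives an element of \<open>\<complex>[T]\<close>.
\<close>

definition eval_X :: "complex \<Rightarrow> int poly poly \<Rightarrow> complex poly" where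
  "eval_X x P = poly (map_poly complex_poly P) [:x:]"

interpretation complex_poly2_hom: map_poly_comm_ring_hom complex_poly ..

lemma complex_poly_const: "complex_poly [:c:] = [:of_int c:]"
  by (rule poly_eqI) (simp add: coeff_map_poly coeff_pCons split: nat.splits)

interpretation eval_X: comm_ring_hom "eval_X x"
  by unfold_locales (auto simp: eval_X_def hom_distribs)

interpretation map_const: map_poly_comm_ring_hom "\<lambda>c::complex. [:c:]" ..

lemma map_poly_const_linear_factors:
  "map_poly (\<lambda>c. [:c:]) (smult c (\<Prod>a\<leftarrow>as. [:- a, 1:])) =
   smult [:c:] (\<Prod>a\<leftarrow>map (\<lambda>c. [:c:]) as. [:- a :: complex poly, 1:])"
proof -
  have "map_poly (\<lambda>c. [:c:]) [:- a, 1:] = [:- [:a:], 1:]" for a :: complex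
    by (rule poly_eqI) (simp add: coeff_map_poly coeff_pCons split: nat.splits)
  hence "map_poly (\<lambda>c. [:c:]) (\<Prod>a\<leftarrow>as. [:- a, 1:]) = (\<Prod>a\<leftarrow>map (\<lambda>c. [:c:]) as. [:- a, 1:])"
    by (induction as) (auto simp: map_const.hom_mult simp del: mult_pCons_left)
  moreover have "map_poly (\<lambda>c. [:c:]) (smult c p) = smult [:c:] (map_poly (\<lambda>c. [:c:]) p)" for p
    by (rule poly_eqI) (simp add: coeff_map_poly)
  ultimately show ?thesis by simp
qed

text \<open>
  Up to sign, \<open>lc(R)^K \<Prod>\<^sub>x S(x, T)\<close> is the resultant of \<open>R\<close> and \<open>S\<close> with respect to \<open>X\<close>, so it
  lies in \<open>\<int>[T]\<close>. It is not zero, so its leading coefficient is a non-zero integer, and this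
  leading coefficient is \<open>lc(R)^K\<close> times the product of those of the \<open>S(x, T)\<close>. The variable \<open>T\<close>
  thus lets the selected coefficient sit in a different degree for each root \<open>x\<close>, so that \<open>R\<close> need
  not be split into the factors on which this degree is constant.
\<close>

lemma lead_coeff_product_ge_1:
  fixes R :: "int poly"
  assumes R: "R \<noteq> 0" and deg: "degree S \<le> K"
    and nz: "\<And>x. poly (complex_poly R) x = 0 \<Longrightarrow> eval_X x S \<noteq> 0"
  shows "1 \<le> cmod (lead_coeff (complex_poly R)) ^ K *
             (\<Prod>x\<leftarrow>complex_roots_complex (complex_poly R). cmod (lead_coeff (eval_X x S)))"
proof -
  define xs where "xs = complex_roots_complex (complex_poly R)"
  define c where "c = lead_coeff (complex_poly R)"
  define r where "r = formal_resultant K (degree R) (map_poly (\<lambda>c. [:c:]) R) S"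
  have R': "complex_poly R \<noteq> 0" using R by simp
  have len: "length xs = degree R" by (simp add: xs_def)
  have lift: "map_poly complex_poly (map_poly (\<lambda>c. [:c:]) R) = map_poly (\<lambda>c. [:c:]) (complex_poly R)"
    by (rule poly_eqI) (simp add: coeff_map_poly complex_poly_const)
  have "map_poly (\<lambda>c. [:c:]) (complex_poly R) = map_poly (\<lambda>c. [:c:]) (smult c (\<Prod>a\<leftarrow>xs. [:- a, 1:]))"
    by (simp only: complex_roots(1) c_def xs_def)
  also have "\<dots> = smult [:c:] (\<Prod>a\<leftarrow>map (\<lambda>c. [:c:]) xs. [:- a, 1:])"
    by (rule map_poly_const_linear_factors)
  finally have "complex_poly r = formal_resultant K (length (map (\<lambda>c. [:c:]) xs) + 0)
      (smult [:c:] (\<Prod>a\<leftarrow>map (\<lambda>c. [:c:]) xs. [:- a, 1:])) (map_poly complex_poly S)"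
    by (simp add: r_def of_int_poly_hom.formal_resultant_hom lift len)
  also have "\<dots> = (-1) ^ (K * length xs) * [:c:] ^ K * (\<Prod>x\<leftarrow>xs. eval_X x S)"
    by (subst formal_resultant_roots)
      (use deg degree_map_poly_le order.trans in \<open>auto simp: eval_X_def o_def\<close>)
  finally have r: "complex_poly r = (-1) ^ (K * length xs) * [:c:] ^ K * (\<Prod>x\<leftarrow>xs. eval_X x S)" .
  have "(\<Prod>x\<leftarrow>xs. eval_X x S) \<noteq> 0"
    using nz R' by (auto simp: prod_list_zero_iff xs_def set_complex_roots_complex)
  moreover have "c \<noteq> 0" using R' by (simp add: c_def)
  ultimately have "complex_poly r \<noteq> 0" by (simp add: r)
  hence "lead_coeff r \<noteq> 0" by auto
  hence "1 \<le> \<bar>real_of_int (lead_coeff r)\<bar>" by linarith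
  also have "\<dots> = cmod (lead_coeff (complex_poly r))" by simp
  also have "\<dots> = cmod c ^ K * (\<Prod>x\<leftarrow>xs. cmod (lead_coeff (eval_X x S)))"
    unfolding r by (simp add: lead_coeff_mult lead_coeff_power lead_coeff_of_prod norm_mult norm_power
        lead_coeff_minus)
  finally show ?thesis by (simp add: c_def xs_def)
qed

text \<open>
  The embedding of \<open>\<int>[X][Y]\<close> into \<open>\<int>[T][X][Y]\<close>.
\<close>

definition lift_T :: "int poly poly \<Rightarrow> int poly poly poly" where
  "lift_T = map_poly (map_poly (\<lambda>c. [:c:]))"

lemma eval_X_lift: "eval_X x (map_poly (\<lambda>c. [:c:]) a) = [:poly (complex_poly a) x:]"
proof -
  have "map_poly complex_poly (map_poly (\<lambda>c. [:c:]) a) = map_poly (\<lambda>c. [:c:]) (complex_poly a)"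
    by (rule poly_eqI) (simp add: coeff_map_poly complex_poly_const)
  thus ?thesis by (simp add: eval_X_def)
qed

lemma coeff_lift_T: "coeff (lift_T F) j = map_poly (\<lambda>c. [:c:]) (coeff F j)"
  by (simp add: lift_T_def coeff_map_poly)

lemma map_eval_X_lift_T:
  "map_poly (eval_X x) (lift_T F) = map_poly (\<lambda>c. [:c:]) (spec_X (complex_poly2 F) x)"
  by (rule poly_eqI) (simp add: coeff_lift_T coeff_map_poly eval_X_lift spec_X_def)

text \<open>
  The first use of \<open>lead_coeff_product_ge_1\<close>: for \<open>S = F(X, T)\<close> the leading coefficient of \<open>S(x, T)\<close>
  is that of \<open>F(x, Y)\<close>, whatever the degree of \<open>F(x, Y)\<close> is.
\<close>

lemma lead_coeff_spec_X_product_ge_1: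
  fixes R :: "int poly"
  assumes R: "R \<noteq> 0" and deg: "\<And>j. degree (coeff F j) \<le> n"
    and nz: "\<And>x. poly (complex_poly R) x = 0 \<Longrightarrow> spec_X (complex_poly2 F) x \<noteq> 0"
  shows "1 \<le> cmod (lead_coeff (complex_poly R)) ^ n *
             (\<Prod>x\<leftarrow>complex_roots_complex (complex_poly R). cmod (lead_coeff (spec_X (complex_poly2 F) x)))"
proof -
  \<comment> \<open>substituting \<open>T\<close> for \<open>Y\<close> turns \<open>F\<close> into a polynomial in \<open>X\<close> over \<open>\<int>[T]\<close>\<close>
  define S where "S = poly (lift_T F) [:[:0, 1:]:]"
  have ev: "eval_X x S = spec_X (complex_poly2 F) x" for x
  proof -
    have "eval_X x [:[:0, 1:]:] = [:0, 1:]" by (simp add: eval_X_def)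
    hence "eval_X x S = poly (map_poly (\<lambda>c. [:c:]) (spec_X (complex_poly2 F) x)) [:0, 1:]"
      by (simp add: S_def map_eval_X_lift_T flip: eval_X.poly_map_poly)
    also have "\<dots> = pcompose (spec_X (complex_poly2 F) x) [:0, 1:]"
      by (simp add: pcompose_altdef)
    finally show ?thesis by (simp only: pcompose_idR)
  qed
  have "degree S \<le> n" unfolding S_def poly_altdef
  proof (intro degree_sum_le)
    fix i :: nat
    have "degree ([:[:0, 1::int:]:] ^ i) \<le> 0"
      using degree_power_le[of "[:[:0, 1::int:]:]" i] by simp
    moreover have "degree (coeff (lift_T F) i) \<le> n"
      using deg[of i] by (simp add: coeff_lift_T)
    ultimately show "degree (coeff (lift_T F) i * [:[:0, 1:]:] ^ i) \<le> n"
      using degree_mult_le[of "coeff (lift_T F) i" "[:[:0, 1:]:] ^ i"] by linarith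
  qed simp
  from lead_coeff_product_ge_1[OF R this] nz show ?thesis by (simp add: ev)
qed

text \<open>
  The polynomial \<open>Y^n + \<Sum>\<^sub>l T^(m+1-l) G\<^sub>l\<close>. At a point \<open>(x, y)\<close> its leading coefficient in \<open>T\<close> is the
  first non-vanishing value among the \<open>G\<^sub>l(x, y)\<close>, because smaller indices come with higher powers
  of \<open>T\<close>. The summand \<open>Y^n\<close> does not disturb this, and for \<open>n\<close> above the degrees of the
  \<open>G\<^sub>l\<close> it makes the polynomial monic in \<open>Y\<close>, so that its resultant with \<open>F\<close> is a product of its values
  at the roots of \<open>F(x, Y)\<close> also where the degree of \<open>F(x, Y)\<close> drops.
\<close>

definition monic_combination :: "nat \<Rightarrow> nat \<Rightarrow> (nat \<Rightarrow> int poly poly) \<Rightarrow> int poly poly poly" where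
  "monic_combination n m G = monom 1 n + (\<Sum>l = 1..m. smult [:monom 1 (Suc m - l):] (lift_T (G l)))"

lemma lead_coeff_first_nonzero:
  fixes c :: "nat \<Rightarrow> 'a :: comm_ring_1"
  assumes l: "l \<in> {1..m}" "c l \<noteq> 0" and least: "\<And>k. k \<in> {1..m} \<Longrightarrow> k < l \<Longrightarrow> c k = 0"
  shows "lead_coeff ([:a:] + (\<Sum>k = 1..m. monom (c k) (Suc m - k))) = c l"
proof -
  let ?p = "[:a:] + (\<Sum>k = 1..m. monom (c k) (Suc m - k))"
  have coeff: "coeff ?p j = (if j = 0 then a else 0) + (\<Sum>k = 1..m. if k = Suc m - j then (if j \<le> m then c k else 0) else 0)" for j
  proof -
    have "(\<Sum>k = 1..m. coeff (monom (c k) (Suc m - k)) j) =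
          (\<Sum>k = 1..m. if k = Suc m - j then (if j \<le> m then c k else 0) else 0)"
      by (intro sum.cong) auto
    thus ?thesis by (simp add: coeff_sum coeff_pCons split: nat.splits)
  qed
  have "Suc m - l \<le> m" "Suc m - (Suc m - l) = l" "Suc m - l \<noteq> 0" using l by auto
  hence "coeff ?p (Suc m - l) = c l" using l(1) by (subst coeff) (simp add: sum.delta)
  moreover have "degree ?p = Suc m - l"
  proof (rule antisym)
    show "degree ?p \<le> Suc m - l"
    proof (rule degree_le, intro allI impI)
      fix j assume "Suc m - l < j"
      thus "coeff ?p j = 0" using l least[of "Suc m - j"] by (subst coeff) (auto simp: sum.delta)
    qed
    show "Suc m - l \<le> degree ?p" using \<open>coeff ?p _ = c l\<close> l by (metis le_degree)
  qed
  ultimately show ?thesis by simp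
qed

text \<open>
  The second use of \<open>lead_coeff_product_ge_1\<close>: \<open>S\<close> is the resultant with respect to \<open>Y\<close> of \<open>F\<close> and
  \<open>H = Y^(n2+1) + \<Sum>\<^sub>l T^(m+1-l) G\<^sub>l\<close>. Up to sign, \<open>S(x, T)\<close> is
  \<open>lc(F(x,Y))^(n2+1) \<Prod>\<^sub>y H(x, y)\<close>, and each factor \<open>H(x, y)\<close> has the leading coefficient
  \<open>G\<^sub>i(x, y)\<close> with \<open>i = i(x, y)\<close>.
\<close>

lemma value_product_ge_1:
  fixes R :: "int poly" and m n1 n2 :: nat
  defines "f \<equiv> \<lambda>F. spec_X (complex_poly2 F)"
  assumes R: "R \<noteq> 0" and nz: "\<And>x. poly (complex_poly R) x = 0 \<Longrightarrow> f F x \<noteq> 0"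
    and degF: "degree F \<le> n1" "\<And>j. degree (coeff F j) \<le> n1"
    and degG: "\<And>l. l \<in> {1..m} \<Longrightarrow> degree (G l) \<le> n2"
              "\<And>l j. l \<in> {1..m} \<Longrightarrow> degree (coeff (G l) j) \<le> n2"
    and i: "\<And>x y. poly (complex_poly R) x = 0 \<Longrightarrow> poly (f F x) y = 0 \<Longrightarrow>
              i (x, y) \<in> {1..m} \<and> poly (f (G (i (x, y))) x) y \<noteq> 0 \<and>
              (\<forall>k\<in>{1..m}. k < i (x, y) \<longrightarrow> poly (f (G k) x) y = 0)"
  shows "1 \<le> cmod (lead_coeff (complex_poly R)) ^ (Suc n2 * n1 + n1 * n2) *
           (\<Prod>x\<leftarrow>complex_roots_complex (complex_poly R). cmod (lead_coeff (f F x)) ^ Suc n2 *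
              (\<Prod>y\<leftarrow>complex_roots_complex (f F x). cmod (poly (f (G (i (x, y))) x) y)))"
proof -
  define H where "H = monic_combination (Suc n2) m G"
  define S where "S = formal_resultant (Suc n2) n1 (lift_T F) H"
  define g where "g x y = poly (map_poly (eval_X x) H) [:y:]" for x y
  have coeff_H: "coeff H j = (if j = Suc n2 then 1 else 0) +
      (\<Sum>l = 1..m. [:monom 1 (Suc m - l):] * map_poly (\<lambda>c. [:c:]) (coeff (G l) j))" for j
    by (simp add: H_def monic_combination_def coeff_sum coeff_lift_T)
  have deg_lift: "degree (map_poly (\<lambda>c. [:c:]) a) = degree a" for a :: "int poly" by simp
  have deg_S: "degree S \<le> Suc n2 * n1 + n1 * n2" unfolding S_def
  proof (rule degree_formal_resultant_le)
    show "degree (coeff (lift_T F) j) \<le> n1" for j using degF(2)[of j] by (simp add: coeff_lift_T)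
    show "degree (coeff H j) \<le> n2" for j unfolding coeff_H
    proof (intro degree_add_le degree_sum_le)
      fix l assume "l \<in> {1..m}"
      thus "degree ([:monom 1 (Suc m - l):] * map_poly (\<lambda>c. [:c:]) (coeff (G l) j)) \<le> n2"
        using degree_mult_le[of "[:monom 1 (Suc m - l):]" "map_poly (\<lambda>c. [:c:]) (coeff (G l) j)"]
          degG(2)[of l j] by (simp add: deg_lift)
    qed auto
  qed
  have ev_S: "eval_X x S = (-1) ^ (Suc n2 * degree (f F x)) * [:lead_coeff (f F x):] ^ Suc n2 *
                   (\<Prod>y\<leftarrow>complex_roots_complex (f F x). g x y)" for x
  proof -
    define ys where "ys = map (\<lambda>c. [:c:]) (complex_roots_complex (f F x))"
    have "degree (f F x) \<le> n1"
      unfolding f_def spec_X_def using degF(1) degree_map_poly_le order.trans by metis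
    then obtain h where h: "n1 = length ys + h" by (auto simp: ys_def le_iff_add)
    have "map_poly (\<lambda>c. [:c:]) (f F x) =
      map_poly (\<lambda>c. [:c:]) (smult (lead_coeff (f F x)) (\<Prod>a\<leftarrow>complex_roots_complex (f F x). [:- a, 1:]))"
      by (simp only: complex_roots(1))
    also have "\<dots> = smult [:lead_coeff (f F x):] (\<Prod>a\<leftarrow>ys. [:- a, 1:])"
      unfolding ys_def by (rule map_poly_const_linear_factors)
    finally have F: "map_poly (\<lambda>c. [:c:]) (f F x) = \<dots>" .
    have "degree H \<le> Suc n2"
      using degG(1) by (intro degree_le) (fastforce simp: coeff_H coeff_eq_0 intro!: sum.neutral)
    moreover have "coeff H (Suc n2) = 1"
      using degG(1) by (fastforce simp: coeff_H coeff_eq_0 intro!: sum.neutral)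
    moreover have "degree (map_poly (eval_X x) H) \<le> Suc n2"
      using \<open>degree H \<le> Suc n2\<close> degree_map_poly_le order.trans by metis
    ultimately have "formal_resultant (Suc n2) (length ys + h)
        (smult [:lead_coeff (f F x):] (\<Prod>a\<leftarrow>ys. [:- a, 1:])) (map_poly (eval_X x) H) =
      (-1) ^ (Suc n2 * length ys) * [:lead_coeff (f F x):] ^ Suc n2 * (\<Prod>y\<leftarrow>ys. poly (map_poly (eval_X x) H) y)"
      by (subst formal_resultant_roots) (auto simp: coeff_map_poly)
    moreover have "eval_X x S = formal_resultant (Suc n2) n1 (map_poly (\<lambda>c. [:c:]) (f F x)) (map_poly (eval_X x) H)"
      by (simp only: S_def eval_X.formal_resultant_hom map_eval_X_lift_T f_def)
    ultimately have "eval_X x S = (-1) ^ (Suc n2 * length ys) * [:lead_coeff (f F x):] ^ Suc n2 *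
        (\<Prod>y\<leftarrow>ys. poly (map_poly (eval_X x) H) y)"
      by (simp only: F h)
    thus ?thesis by (simp add: ys_def o_def g_def)
  qed
  have lead_g: "lead_coeff (g x y) = poly (f (G (i (x, y))) x) y"
    if "poly (complex_poly R) x = 0" "poly (f F x) y = 0" for x y
  proof -
    have "map_poly (eval_X x) H = monom 1 (Suc n2) +
      (\<Sum>l = 1..m. smult (monom 1 (Suc m - l)) (map_poly (\<lambda>c. [:c:]) (f (G l) x)))"
    proof (rule poly_eqI)
      fix j
      have "eval_X x [:monom 1 k:] = monom 1 k" for k
        by (simp add: eval_X_def)
      hence "eval_X x (coeff H j) = (if j = Suc n2 then 1 else 0) +
          (\<Sum>l = 1..m. monom 1 (Suc m - l) * [:poly (complex_poly (coeff (G l) j)) x:])"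
        by (simp only: coeff_H eval_X.hom_add eval_X.hom_sum eval_X.hom_mult eval_X_lift
            if_distrib[of "eval_X x"] eval_X.hom_one eval_X.hom_zero)
      thus "coeff (map_poly (eval_X x) H) j = coeff (monom 1 (Suc n2) +
          (\<Sum>l = 1..m. smult (monom 1 (Suc m - l)) (map_poly (\<lambda>c. [:c:]) (f (G l) x)))) j"
        by (simp add: coeff_map_poly coeff_sum f_def spec_X_def mult.commute)
    qed
    hence "g x y = [:y ^ Suc n2:] + (\<Sum>k = 1..m. monom (poly (f (G k) x) y) (Suc m - k))"
      by (simp add: g_def poly_sum poly_monom coeff_lift_hom.poly_map_poly smult_monom monom_altdef
          mult.commute flip: coeff_lift_hom.hom_power)
    also have "lead_coeff \<dots> = poly (f (G (i (x, y))) x) y"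
      using i[OF that] by (intro lead_coeff_first_nonzero) auto
    finally show ?thesis .
  qed
  have lead_S: "cmod (lead_coeff (eval_X x S)) = cmod (lead_coeff (f F x)) ^ Suc n2 *
      (\<Prod>y\<leftarrow>complex_roots_complex (f F x). cmod (poly (f (G (i (x, y))) x) y))"
    if x: "poly (complex_poly R) x = 0" for x
  proof -
    have "cmod (lead_coeff (eval_X x S)) = cmod (lead_coeff (f F x)) ^ Suc n2 *
      (\<Prod>y\<leftarrow>complex_roots_complex (f F x). cmod (lead_coeff (g x y)))"
      unfolding ev_S by (simp add: lead_coeff_mult lead_coeff_power lead_coeff_of_prod norm_mult norm_power)
    also have "map (\<lambda>y. cmod (lead_coeff (g x y))) (complex_roots_complex (f F x)) =
               map (\<lambda>y. cmod (poly (f (G (i (x, y))) x) y)) (complex_roots_complex (f F x))"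
      using x lead_g nz[OF x] by (intro map_cong) (auto simp: set_complex_roots_complex)
    finally show ?thesis .
  qed
  have "eval_X x S \<noteq> 0" if x: "poly (complex_poly R) x = 0" for x
  proof -
    have "cmod (lead_coeff (eval_X x S)) \<noteq> 0"
      using nz[OF x] i[OF x] by (auto simp: lead_S[OF x] prod_list_zero_iff set_complex_roots_complex)
    thus ?thesis by auto
  qed
  from lead_coeff_product_ge_1[OF R deg_S this]
  have "1 \<le> cmod (lead_coeff (complex_poly R)) ^ (Suc n2 * n1 + n1 * n2) *
          (\<Prod>x\<leftarrow>complex_roots_complex (complex_poly R). cmod (lead_coeff (eval_X x S)))" .
  also have "map (\<lambda>x. cmod (lead_coeff (eval_X x S))) (complex_roots_complex (complex_poly R)) =
    map (\<lambda>x. cmod (lead_coeff (f F x)) ^ Suc n2 *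
      (\<Prod>y\<leftarrow>complex_roots_complex (f F x). cmod (poly (f (G (i (x, y))) x) y)))
      (complex_roots_complex (complex_poly R))"
    using R lead_S by (intro map_cong) (auto simp: set_complex_roots_complex)
  finally show ?thesis .
qed

section \<open>Upper bounds for values and roots of polynomials\<close>

definition log_plus :: "complex \<Rightarrow> real" where
  "log_plus z = ln (max 1 (cmod z))"

lemma log_plus_nonneg: "0 \<le> log_plus z"
  by (simp add: log_plus_def)

lemma ln_prod_list:
  fixes \<phi> :: "'a \<Rightarrow> real"
  assumes "\<And>a. a \<in> set xs \<Longrightarrow> 0 < \<phi> a"
  shows "0 < (\<Prod>a\<leftarrow>xs. \<phi> a) \<and> ln (\<Prod>a\<leftarrow>xs. \<phi> a) = (\<Sum>a\<leftarrow>xs. ln (\<phi> a))"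
  using assms
proof (induction xs)
  case (Cons a xs)
  hence "0 < \<phi> a" "0 < (\<Prod>a\<leftarrow>xs. \<phi> a)" "ln (\<Prod>a\<leftarrow>xs. \<phi> a) = (\<Sum>a\<leftarrow>xs. ln (\<phi> a))" by auto
  thus ?case by (simp only: list.map prod_list.Cons sum_list.Cons ln_mult_pos mult_pos_pos simp_thms)
qed simp

lemma l2norm_complex_le:
  assumes deg: "degree p \<le> n" and coeff: "\<And>i. cmod (coeff p i) \<le> B"
  shows "l2norm_complex p \<le> (real n + 1) * B"
proof -
  have B: "0 \<le> B" using coeff[of 0] norm_ge_zero order.trans by blast
  have "(\<Sum>a\<leftarrow>coeffs p. (cmod a)\<^sup>2) \<le> (\<Sum>a\<leftarrow>coeffs p. B\<^sup>2)"
    by (rule sum_list_mono) (use coeff in \<open>auto simp: coeffs_def intro!: power_mono split: if_splits\<close>)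
  also have "\<dots> = real (length (coeffs p)) * B\<^sup>2" by (simp add: sum_list_triv)
  also have "\<dots> \<le> (real n + 1)\<^sup>2 * B\<^sup>2"
  proof (rule mult_right_mono)
    have "real (length (coeffs p)) \<le> real n + 1" using deg by (cases "p = 0") (auto simp: length_coeffs)
    also have "\<dots> \<le> (real n + 1)\<^sup>2" by (simp add: power2_eq_square)
    finally show "real (length (coeffs p)) \<le> (real n + 1)\<^sup>2" .
  qed simp
  also have "\<dots> = ((real n + 1) * B)\<^sup>2" by (simp add: power_mult_distrib)
  finally show ?thesis using B by (intro real_le_lsqrt) (auto intro!: sum_list_nonneg)
qed

text \<open>
  Landau's inequality for the Mahler measure, in logarithmic form.
\<close>

lemma sum_log_plus_roots_le:
  assumes p: "p \<noteq> 0" and deg: "degree p \<le> n" and coeff: "\<And>i. cmod (coeff p i) \<le> B"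
  shows "(\<Sum>a\<leftarrow>complex_roots_complex p. log_plus a) + ln (cmod (lead_coeff p)) \<le> ln ((real n + 1) * B)"
proof -
  let ?P = "\<Prod>a\<leftarrow>complex_roots_complex p. max 1 (cmod a)"
  have P: "0 < ?P" "ln ?P = (\<Sum>a\<leftarrow>complex_roots_complex p. log_plus a)"
    using ln_prod_list[of "complex_roots_complex p" "\<lambda>a. max 1 (cmod a)"] by (auto simp: log_plus_def)
  have lc: "0 < cmod (lead_coeff p)" using p by simp
  have "cmod (lead_coeff p) * ?P \<le> (real n + 1) * B"
    using Landau_inequality[of p] l2norm_complex_le[OF deg coeff] unfolding mahler_measure_poly_def by linarith
  hence "ln (cmod (lead_coeff p) * ?P) \<le> ln ((real n + 1) * B)"
    using lc P(1) by (intro ln_mono mult_pos_pos)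
  moreover have "ln (cmod (lead_coeff p) * ?P) = ln (cmod (lead_coeff p)) + ln ?P"
    using lc P(1) by (rule ln_mult_pos)
  ultimately show ?thesis using P(2) by linarith
qed

lemma cmod_poly_le:
  assumes deg: "degree p \<le> n" and coeff: "\<And>i. cmod (coeff p i) \<le> B"
  shows "cmod (poly p x) \<le> (real n + 1) * B * max 1 (cmod x) ^ n"
proof -
  have B: "0 \<le> B" using coeff[of 0] norm_ge_zero order.trans by blast
  have "p = (\<Sum>i\<le>n. monom (coeff p i) i)" using poly_as_sum_of_monoms'[OF deg] by simp
  hence "poly p x = (\<Sum>i\<le>n. coeff p i * x ^ i)" by (metis (no_types, lifting) poly_monom poly_sum sum.cong)
  hence "cmod (poly p x) \<le> (\<Sum>i\<le>n. cmod (coeff p i * x ^ i))" by (simp add: norm_sum)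
  also have "\<dots> \<le> (\<Sum>i\<le>n. B * max 1 (cmod x) ^ n)"
  proof (rule sum_mono)
    fix i assume "i \<in> {..n}"
    have "cmod x ^ i \<le> max 1 (cmod x) ^ i" by (intro power_mono) auto
    also have "\<dots> \<le> max 1 (cmod x) ^ n" using \<open>i \<in> _\<close> by (intro power_increasing) auto
    finally show "cmod (coeff p i * x ^ i) \<le> B * max 1 (cmod x) ^ n"
      using coeff[of i] B by (simp add: norm_mult norm_power mult_mono)
  qed
  finally show ?thesis by (simp add: algebra_simps)
qed

lemma magnitude2_degree:
  assumes "magnitude2 F n \<tau>"
  shows "degree F \<le> n" "degree (coeff F j) \<le> n"
proof -
  have *: "i + j \<le> n" if "coeff (coeff F j) i \<noteq> 0" for i j
    using assms that by (auto simp: magnitude2_def total_degree_le_iff)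
  show "degree (coeff F j) \<le> n"
    by (rule degree_le) (use * in \<open>force simp: not_le\<close>)
  show "degree F \<le> n"
  proof (rule degree_le, intro allI impI, rule ccontr)
    fix j assume "n < j" "coeff F j \<noteq> 0"
    then obtain i where "coeff (coeff F j) i \<noteq> 0" by (meson leading_coeff_neq_0)
    from *[OF this] \<open>n < j\<close> show False by simp
  qed
qed

lemma degree_spec_X_le: "degree (spec_X F x) \<le> degree F"
  unfolding spec_X_def by (rule degree_map_poly_le)

lemma cmod_coeff_spec_X_le:
  assumes "magnitude2 F n \<tau>"
  shows "cmod (coeff (spec_X F x) j) \<le> (real n + 1) * 2 ^ \<tau> * max 1 (cmod x) ^ n"
  using cmod_poly_le[OF magnitude2_degree(2)[OF assms], of j "2 ^ \<tau>" x] assms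
  by (simp add: spec_X_def coeff_map_poly magnitude2_def)

text \<open>
  The argument is \<open>n + 1\<close> times the bound for the coefficients of \<open>F(x, Y)\<close>. It bounds both the
  Euclidean norm of \<open>F(x, Y)\<close> and, up to the factor \<open>max 1 \<bar>y\<bar> ^ n\<close>, the value \<open>F(x, y)\<close>.
\<close>

lemma ln_bound_eq:
  "ln ((real n + 1) * ((real n + 1) * 2 ^ \<tau> * max 1 (cmod x) ^ n)) =
   2 * ln (real n + 1) + real \<tau> * ln 2 + real n * log_plus x"
proof -
  have "0 < max 1 (cmod x)" by linarith
  thus ?thesis by (simp add: ln_mult ln_realpow log_plus_def)
qed

lemma ln_eval2_le:
  assumes G: "magnitude2 G n \<tau>" and nz: "eval2 G x y \<noteq> 0"
  shows "ln (cmod (eval2 G x y)) \<le> 2 * ln (real n + 1) + real \<tau> + real n * log_plus x + real n * log_plus y"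
proof -
  define B where "B = (real n + 1) * 2 ^ \<tau> * max 1 (cmod x) ^ n"
  have M: "0 < max 1 (cmod x)" "0 < max 1 (cmod y)" by linarith+
  have "cmod (eval2 G x y) \<le> (real n + 1) * B * max 1 (cmod y) ^ n"
    unfolding eval2_def B_def
    using degree_spec_X_le[of G x] magnitude2_degree(1)[OF G] cmod_coeff_spec_X_le[OF G]
    by (intro cmod_poly_le) auto
  hence "ln (cmod (eval2 G x y)) \<le> ln ((real n + 1) * B * max 1 (cmod y) ^ n)"
    using nz by (intro ln_mono) auto
  also have "\<dots> = ln ((real n + 1) * B) + real n * log_plus y"
    using M by (simp add: ln_mult ln_realpow log_plus_def B_def)
  also have "\<dots> \<le> 2 * ln (real n + 1) + real \<tau> + real n * log_plus x + real n * log_plus y"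
    using mult_left_mono[of "ln 2" 1 "real \<tau>"] ln_2_less_1 unfolding B_def ln_bound_eq by simp
  finally show ?thesis .
qed

lemma sum_list_double_mono:
  fixes \<phi> \<psi> :: "'a \<Rightarrow> 'b \<Rightarrow> real"
  assumes "\<And>x y. x \<in> set xs \<Longrightarrow> y \<in> set (ys x) \<Longrightarrow> \<phi> x y \<le> \<psi> x y"
  shows "(\<Sum>x\<leftarrow>xs. \<Sum>y\<leftarrow>ys x. \<phi> x y) \<le> (\<Sum>x\<leftarrow>xs. \<Sum>y\<leftarrow>ys x. \<psi> x y)"
  using assms by (intro sum_list_mono) auto

section \<open>Estimates for the system of \<open>R\<close> and \<open>F\<close>\<close>

text \<open>
  The logarithmic factor of the final bound is represented by a number \<open>L \<ge> 1\<close> that dominates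
  the logarithms of the degrees. The lists \<open>xs\<close> and \<open>ys x\<close> contain the roots of \<open>R\<close> and of
  \<open>F(x, Y)\<close> with multiplicity, so the weights \<open>\<mu>(x) \<nu>(y)\<close> become a double sum over these lists.
\<close>

locale zero_dimensional_system =
  fixes R :: "int poly" and F :: "int poly poly" and N \<Lambda> n1 \<tau>1 :: nat and L :: real
  assumes R: "R \<noteq> 0" and mag_R: "magnitude (complex_poly R) N \<Lambda>"
    and mag_F: "magnitude2 (complex_poly2 F) n1 \<tau>1"
    and fin: "finite (zeros R F)"
    and L: "1 \<le> L" "ln (real N + 1) \<le> L" "ln (real n1 + 1) \<le> L"
begin

abbreviation "xs \<equiv> complex_roots_complex (complex_poly R)"
abbreviation "f x \<equiv> spec_X (complex_poly2 F) x"
abbreviation "ys x \<equiv> complex_roots_complex (f x)"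
abbreviation "lc \<equiv> cmod (lead_coeff (complex_poly R))"

lemma spec_X_nonzero:
  assumes "poly (complex_poly R) x = 0"
  shows "f x \<noteq> 0"
proof
  assume "f x = 0"
  hence "Pair x ` UNIV \<subseteq> zeros R F" using assms by (auto simp: zeros_def eval2_def)
  hence "finite (Pair x ` (UNIV :: complex set))" using fin by (rule finite_subset)
  hence "finite (UNIV :: complex set)" by (rule finite_imageD) (auto simp: inj_on_def)
  thus False using infinite_UNIV_char_0 by blast
qed

lemma set_xs: "set xs = {x. poly (complex_poly R) x = 0}"
  using R by (simp add: set_complex_roots_complex)

lemma set_ys: "x \<in> set xs \<Longrightarrow> set (ys x) = {y. poly (f x) y = 0}"
  using spec_X_nonzero by (simp add: set_complex_roots_complex set_xs)

lemma length_xs: "length xs \<le> N"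
  using mag_R by (simp add: magnitude_def)

lemma length_ys: "length (ys x) \<le> n1"
  using degree_spec_X_le[of "complex_poly2 F" x] magnitude2_degree(1)[OF mag_F] by simp

lemma sum_zeros:
  "(\<Sum>(x, y)\<in>zeros R F. real (order x (complex_poly R)) * real (order y (f x)) * \<phi> x y) =
   (\<Sum>x\<leftarrow>xs. \<Sum>y\<leftarrow>ys x. \<phi> x y)"
proof -
  have zeros: "zeros R F = Sigma {x. poly (complex_poly R) x = 0} (\<lambda>x. {y. poly (f x) y = 0})"
    by (auto simp: zeros_def eval2_def)
  have "(\<Sum>x\<leftarrow>xs. \<Sum>y\<leftarrow>ys x. \<phi> x y) = (\<Sum>x | poly (complex_poly R) x = 0.
      real (order x (complex_poly R)) * (\<Sum>y\<leftarrow>ys x. \<phi> x y))"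
    using R by (simp add: sum_list_complex_roots)
  also have "\<dots> = (\<Sum>x | poly (complex_poly R) x = 0. \<Sum>y | poly (f x) y = 0.
      real (order x (complex_poly R)) * real (order y (f x)) * \<phi> x y)"
    using spec_X_nonzero by (intro sum.cong) (auto simp: sum_list_complex_roots sum_distrib_left mult_ac)
  also have "\<dots> = (\<Sum>(x, y)\<in>zeros R F. real (order x (complex_poly R)) * real (order y (f x)) * \<phi> x y)"
    unfolding zeros using R spec_X_nonzero by (subst sum.Sigma) (auto simp: poly_roots_finite)
  finally show ?thesis ..
qed

lemma ln_lc_bounds: "0 \<le> ln lc" "ln lc \<le> \<Lambda>"
proof -
  have "lead_coeff R \<noteq> 0" using R by simp
  hence "1 \<le> \<bar>real_of_int (lead_coeff R)\<bar>" by linarith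
  hence lc: "1 \<le> lc" by simp
  thus "0 \<le> ln lc" by simp
  have "ln lc \<le> ln (2 ^ \<Lambda>)" using lc mag_R by (intro ln_mono) (auto simp: magnitude_def simp del: leading_coeff_neq_0)
  also have "\<dots> \<le> \<Lambda>" using mult_left_mono[of "ln 2" 1 "real \<Lambda>"] ln_2_less_1 by (simp add: ln_realpow)
  finally show "ln lc \<le> \<Lambda>" .
qed

lemma sum_log_plus_xs_le: "(\<Sum>x\<leftarrow>xs. log_plus x) \<le> L + \<Lambda>"
proof -
  have "(\<Sum>x\<leftarrow>xs. log_plus x) + ln lc \<le> ln ((real N + 1) * 2 ^ \<Lambda>)"
    using R mag_R by (intro sum_log_plus_roots_le) (auto simp: magnitude_def)
  also have "\<dots> = ln (real N + 1) + \<Lambda> * ln 2" by (simp add: ln_mult ln_realpow)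
  also have "\<dots> \<le> L + \<Lambda>" using L mult_left_mono[of "ln 2" 1 "real \<Lambda>"] ln_2_less_1 by simp
  finally show ?thesis using ln_lc_bounds by simp
qed

lemma sum_log_plus_ys_le:
  assumes "x \<in> set xs"
  shows "(\<Sum>y\<leftarrow>ys x. log_plus y) + ln (cmod (lead_coeff (f x))) \<le> 2 * L + \<tau>1 + n1 * log_plus x"
proof -
  have "(\<Sum>y\<leftarrow>ys x. log_plus y) + ln (cmod (lead_coeff (f x))) \<le>
      2 * ln (real n1 + 1) + real \<tau>1 * ln 2 + real n1 * log_plus x"
    unfolding ln_bound_eq[symmetric]
    using assms spec_X_nonzero magnitude2_degree(1)[OF mag_F] degree_spec_X_le[of "complex_poly2 F" x]
    by (intro sum_log_plus_roots_le cmod_coeff_spec_X_le[OF mag_F]) (auto simp: set_xs)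
  also have "\<dots> \<le> 2 * L + \<tau>1 + n1 * log_plus x"
    using L mult_left_mono[of "ln 2" 1 "real \<tau>1"] ln_2_less_1 by simp
  finally show ?thesis .
qed

lemma degree_F: "degree F \<le> n1" "degree (coeff F j) \<le> n1"
  using magnitude2_degree(1)[OF mag_F] magnitude2_degree(2)[OF mag_F, of j] by (simp_all add: coeff_map_poly)

text \<open>
  Landau's inequality for \<open>F(x, Y)\<close> bounds its roots only if its leading coefficient is not too
  small. For a single \<open>x\<close> this can fail, but not on average over the roots of \<open>R\<close>.
\<close>

lemma sum_ln_lead_coeff_ge: "- (real n1 * ln lc) \<le> (\<Sum>x\<leftarrow>xs. ln (cmod (lead_coeff (f x))))"
proof -
  let ?P = "\<Prod>x\<leftarrow>xs. cmod (lead_coeff (f x))"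
  have P: "0 < ?P \<and> ln ?P = (\<Sum>x\<leftarrow>xs. ln (cmod (lead_coeff (f x))))"
    by (rule ln_prod_list) (use spec_X_nonzero set_xs in auto)
  have lc: "0 < lc" using R by simp
  have "0 \<le> ln (lc ^ n1 * ?P)"
    using lead_coeff_spec_X_product_ge_1[OF R degree_F(2) spec_X_nonzero] by (rule ln_ge_zero)
  also have "\<dots> = ln (lc ^ n1) + ln ?P" using lc P by (intro ln_mult_pos) auto
  finally show ?thesis using P lc by (simp only: ln_realpow)
qed

text \<open>
  The two summands are kept together: dropping the second one needs its lower bound, and dropping
  the first, non-negative one gives the upper bound of the second.
\<close>

lemma sum_log_plus_plus_ln_lead_coeff_le:
  "(\<Sum>x\<leftarrow>xs. \<Sum>y\<leftarrow>ys x. log_plus y) + (\<Sum>x\<leftarrow>xs. ln (cmod (lead_coeff (f x)))) \<le>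
   N * (2 * L + \<tau>1) + n1 * (L + \<Lambda>)"
proof -
  have "(\<Sum>x\<leftarrow>xs. \<Sum>y\<leftarrow>ys x. log_plus y) + (\<Sum>x\<leftarrow>xs. ln (cmod (lead_coeff (f x)))) =
    (\<Sum>x\<leftarrow>xs. (\<Sum>y\<leftarrow>ys x. log_plus y) + ln (cmod (lead_coeff (f x))))"
    by (simp add: sum_list_addf)
  also have "\<dots> \<le> (\<Sum>x\<leftarrow>xs. 2 * L + \<tau>1 + n1 * log_plus x)"
    by (rule sum_list_mono) (rule sum_log_plus_ys_le)
  also have "\<dots> = length xs * (2 * L + \<tau>1) + n1 * (\<Sum>x\<leftarrow>xs. log_plus x)"
    by (simp only: sum_list_addf sum_list_triv sum_list_const_mult distrib_left)
  also have "\<dots> \<le> N * (2 * L + \<tau>1) + n1 * (L + \<Lambda>)"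
    using length_xs sum_log_plus_xs_le L by (intro add_mono mult_mono) (auto intro!: sum_list_nonneg log_plus_nonneg)
  finally show ?thesis .
qed

lemma sum_log_plus_all_ys_le:
  "(\<Sum>x\<leftarrow>xs. \<Sum>y\<leftarrow>ys x. log_plus y) \<le> N * (2 * L + \<tau>1) + n1 * (L + 2 * \<Lambda>)"
proof -
  have "real n1 * ln lc \<le> real n1 * real \<Lambda>" using ln_lc_bounds by (intro mult_left_mono) auto
  thus ?thesis
    using sum_log_plus_plus_ln_lead_coeff_le sum_ln_lead_coeff_ge by (simp add: algebra_simps)
qed

lemma sum_affine_log_plus_le:
  fixes a :: real and n :: nat
  assumes a: "0 \<le> a"
  shows "(\<Sum>x\<leftarrow>xs. \<Sum>y\<leftarrow>ys x. a + n * log_plus x + n * log_plus y) \<le>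
    N * n1 * a + n * (N * (2 * L + \<tau>1) + n1 * (2 * L + 3 * \<Lambda>))"
proof -
  have "(\<Sum>x\<leftarrow>xs. \<Sum>y\<leftarrow>ys x. a + n * log_plus x + n * log_plus y) =
    (\<Sum>x\<leftarrow>xs. length (ys x) * (a + n * log_plus x)) + n * (\<Sum>x\<leftarrow>xs. \<Sum>y\<leftarrow>ys x. log_plus y)"
    by (simp only: sum_list_addf sum_list_triv sum_list_const_mult distrib_left)
  also have "(\<Sum>x\<leftarrow>xs. length (ys x) * (a + n * log_plus x)) \<le> (\<Sum>x\<leftarrow>xs. n1 * (a + n * log_plus x))"
    using length_ys log_plus_nonneg a by (intro sum_list_mono mult_right_mono) auto
  also have "\<dots> = n1 * (length xs * a + n * (\<Sum>x\<leftarrow>xs. log_plus x))"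
    by (simp only: sum_list_addf sum_list_triv sum_list_const_mult distrib_left mult.left_commute)
  also have "\<dots> \<le> n1 * (N * a + n * (L + \<Lambda>))"
    using length_xs a sum_log_plus_xs_le by (intro mult_left_mono add_mono mult_right_mono) auto
  also have "n * (\<Sum>x\<leftarrow>xs. \<Sum>y\<leftarrow>ys x. log_plus y) \<le> n * (N * (2 * L + \<tau>1) + n1 * (L + 2 * \<Lambda>))"
    using sum_log_plus_all_ys_le by (rule mult_left_mono) simp
  finally show ?thesis by (simp add: algebra_simps)
qed

text \<open>
  In \<open>value_product_ge_1\<close> the values \<open>G\<^sub>i(x, y)\<close> come with powers of \<open>lc(R)\<close> and of \<open>lc(F(x, Y))\<close>. These
  are not too large, by the bound for the coefficients of \<open>R\<close> and by
  \<open>sum_log_plus_plus_ln_lead_coeff_le\<close>, so the values cannot be too small on average.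
\<close>

lemma sum_ln_values_ge:
  fixes G :: "nat \<Rightarrow> int poly poly"
  assumes G: "\<And>l. l \<in> {1..m} \<Longrightarrow> magnitude2 (complex_poly2 (G l)) n2 \<tau>2"
    and i: "\<And>x y. (x, y) \<in> zeros R F \<Longrightarrow>
              i (x, y) \<in> {1..m} \<and> eval2 (complex_poly2 (G (i (x, y)))) x y \<noteq> 0 \<and>
              (\<forall>k\<in>{1..m}. k < i (x, y) \<longrightarrow> eval2 (complex_poly2 (G k)) x y = 0)"
  shows "- (\<Sum>x\<leftarrow>xs. \<Sum>y\<leftarrow>ys x. ln (cmod (eval2 (complex_poly2 (G (i (x, y)))) x y))) \<le>
     real (n1 + 2 * n1 * n2) * real \<Lambda> + (real n2 + 1) * (N * (2 * L + \<tau>1) + n1 * (L + \<Lambda>))"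
proof -
  define g where "g x y = cmod (eval2 (complex_poly2 (G (i (x, y)))) x y)" for x y
  define K where "K = Suc n2 * n1 + n1 * n2"
  let ?a = "\<lambda>x. cmod (lead_coeff (f x))"
  let ?P = "\<lambda>x. \<Prod>y\<leftarrow>ys x. g x y"
  have degG: "degree (G l) \<le> n2" "degree (coeff (G l) j) \<le> n2" if "l \<in> {1..m}" for l j
    using magnitude2_degree(1)[OF G[OF that]] magnitude2_degree(2)[OF G[OF that], of j] by (simp_all add: coeff_map_poly)
  have "1 \<le> lc ^ K * (\<Prod>x\<leftarrow>xs. ?a x ^ Suc n2 * ?P x)"
    unfolding K_def g_def eval2_def
    using degG i by (intro value_product_ge_1[OF R spec_X_nonzero degree_F, of m])
      (auto simp: zeros_def eval2_def)
  moreover have P: "0 < ?P x \<and> ln (?P x) = (\<Sum>y\<leftarrow>ys x. ln (g x y))" if "x \<in> set xs" for x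
    by (rule ln_prod_list) (use that i set_xs set_ys in \<open>auto simp: g_def zeros_def eval2_def\<close>)
  moreover have a: "0 < ?a x" if "x \<in> set xs" for x
    using that spec_X_nonzero by (simp add: set_xs)
  have "0 < (\<Prod>x\<leftarrow>xs. ?a x ^ Suc n2 * ?P x) \<and>
      ln (\<Prod>x\<leftarrow>xs. ?a x ^ Suc n2 * ?P x) = (\<Sum>x\<leftarrow>xs. ln (?a x ^ Suc n2 * ?P x))"
    by (rule ln_prod_list) (use P a in auto)
  moreover have "(\<Sum>x\<leftarrow>xs. ln (?a x ^ Suc n2 * ?P x)) =
      (\<Sum>x\<leftarrow>xs. (real n2 + 1) * ln (?a x) + (\<Sum>y\<leftarrow>ys x. ln (g x y)))"
  proof (intro arg_cong[of _ _ sum_list] map_cong refl)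
    fix x assume x: "x \<in> set xs"
    have "ln (?a x ^ Suc n2 * ?P x) = ln (?a x ^ Suc n2) + ln (?P x)"
      using P[OF x] a[OF x] by (intro ln_mult_pos) auto
    thus "ln (?a x ^ Suc n2 * ?P x) = (real n2 + 1) * ln (?a x) + (\<Sum>y\<leftarrow>ys x. ln (g x y))"
      using P[OF x] a[OF x] ln_realpow[of "?a x" "Suc n2"] by simp
  qed
  moreover have "\<dots> = (real n2 + 1) * (\<Sum>x\<leftarrow>xs. ln (?a x)) + (\<Sum>x\<leftarrow>xs. \<Sum>y\<leftarrow>ys x. ln (g x y))"
    by (simp only: sum_list_addf sum_list_const_mult)
  moreover have lc: "0 < lc" using R by simp
  ultimately have "0 \<le> real K * ln lc + ((real n2 + 1) * (\<Sum>x\<leftarrow>xs. ln (?a x)) + (\<Sum>x\<leftarrow>xs. \<Sum>y\<leftarrow>ys x. ln (g x y)))"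
    by (metis (no_types, lifting) ln_ge_zero ln_mult_pos ln_realpow zero_less_power)
  moreover have "real K * ln lc \<le> real K * real \<Lambda>" using ln_lc_bounds by (intro mult_left_mono) auto
  moreover have "(\<Sum>x\<leftarrow>xs. ln (?a x)) \<le> N * (2 * L + \<tau>1) + n1 * (L + \<Lambda>)"
  proof -
    have "0 \<le> (\<Sum>x\<leftarrow>xs. \<Sum>y\<leftarrow>ys x. log_plus y)"
      by (intro sum_list_nonneg) (auto intro!: sum_list_nonneg log_plus_nonneg)
    thus ?thesis using sum_log_plus_plus_ln_lead_coeff_le by simp
  qed
  hence "(real n2 + 1) * (\<Sum>x\<leftarrow>xs. ln (?a x)) \<le> (real n2 + 1) * (N * (2 * L + \<tau>1) + n1 * (L + \<Lambda>))"
    by (rule mult_left_mono) simp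
  moreover have "real K * real \<Lambda> = real (n1 + 2 * n1 * n2) * real \<Lambda>" by (simp add: K_def algebra_simps)
  ultimately show ?thesis unfolding g_def by linarith
qed

text \<open>
  The number \<open>U x y \<ge> 0\<close> bounds \<open>ln \<bar>G(x, y)\<bar>\<close> from above for all polynomials \<open>G\<close> of magnitude
  \<open>(n2, \<tau>2)\<close> with \<open>G(x, y) \<noteq> 0\<close> at once, so the choice of \<open>G\<close> may vary with the point. The number
  \<open>B\<close> is the claimed bound without its logarithmic factor.
\<close>

context
  fixes n2 \<tau>2 :: nat and U :: "complex \<Rightarrow> complex \<Rightarrow> real" and B :: real
  assumes pos: "0 < \<Lambda>" "0 < \<tau>1" "0 < n2" "0 < \<tau>2" and ln_n2: "ln (real n2 + 1) \<le> L"
  defines "U \<equiv> \<lambda>x y. 2 * ln (real n2 + 1) + \<tau>2 + n2 * log_plus x + n2 * log_plus y"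
    and "B \<equiv> real ((\<tau>2 * n1 + \<tau>1 * n2) * N + (\<Lambda> + N) * n1 * n2)"
begin

text \<open>
  Lower-order summands \<open>L\<close> and \<open>t\<close> are absorbed into \<open>L t\<close>, because both factors are at least 1.
\<close>

lemma log_absorb:
  assumes "0 < t" "0 \<le> c" "0 \<le> d"
  shows "c * L + d * real t \<le> (c + d) * (L * real t)"
proof -
  have "c * (L * 1) \<le> c * (L * real t)" "d * (1 * real t) \<le> d * (L * real t)"
    using assms L by (intro mult_left_mono mult_right_mono; simp)+
  thus ?thesis by (simp add: algebra_simps)
qed

lemma U_nonneg: "0 \<le> U x y"
  by (simp add: U_def log_plus_nonneg)

lemma sum_U_le: "(\<Sum>x\<leftarrow>xs. \<Sum>y\<leftarrow>ys x. U x y) \<le> 5 * (B * L)"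
proof -
  have "(\<Sum>x\<leftarrow>xs. \<Sum>y\<leftarrow>ys x. U x y) \<le> real (N * n1) * (2 * ln (real n2 + 1) + \<tau>2) +
      n2 * (N * (2 * L + \<tau>1) + n1 * (2 * L + 3 * \<Lambda>))"
    using sum_affine_log_plus_le[of "2 * ln (real n2 + 1) + \<tau>2" n2] by (simp add: U_def)
  also have "\<dots> \<le> real (N * n1) * (3 * (L * \<tau>2)) + n2 * (N * (3 * (L * \<tau>1)) + n1 * (5 * (L * \<Lambda>)))"
    using log_absorb[of \<tau>2 2 1] log_absorb[of \<tau>1 2 1] log_absorb[of \<Lambda> 2 3] pos ln_n2
    by (intro add_mono mult_left_mono) auto
  also have "\<dots> = 3 * (real (\<tau>2 * n1 * N + \<tau>1 * n2 * N) * L) + 5 * (real (\<Lambda> * n1 * n2) * L)"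
    by (simp add: algebra_simps)
  also have "\<dots> \<le> 5 * (real (\<tau>2 * n1 * N + \<tau>1 * n2 * N) * L) + 5 * (real (\<Lambda> * n1 * n2) * L) +
      5 * (real (N * n1 * n2) * L)"
    using L by simp
  also have "\<dots> = 5 * (B * L)" by (simp add: B_def algebra_simps)
  finally show ?thesis .
qed

text \<open>
  Since \<open>U\<close> is non-negative, the sum over \<open>A\<close> is at most the sum of \<open>U\<close> over all zeros.
\<close>

theorem sum_ln_le:
  assumes G: "\<And>l. l \<in> {1..m} \<Longrightarrow> magnitude2 (G l) n2 \<tau>2" and A: "A \<subseteq> zeros R F"
    and i: "\<And>x y. (x, y) \<in> A \<Longrightarrow> i (x, y) \<in> {1..m} \<and> eval2 (G (i (x, y))) x y \<noteq> 0"
  shows "(\<Sum>(x, y)\<in>A. real (order x (complex_poly R)) * real (order y (f x)) *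
            ln (cmod (eval2 (G (i (x, y))) x y))) \<le> 5 * (B * L)"
proof -
  have "(\<Sum>(x, y)\<in>A. real (order x (complex_poly R)) * real (order y (f x)) *
            ln (cmod (eval2 (G (i (x, y))) x y))) \<le>
        (\<Sum>(x, y)\<in>A. real (order x (complex_poly R)) * real (order y (f x)) * U x y)"
  proof (intro sum_mono, clarify)
    fix x y assume "(x, y) \<in> A"
    thus "real (order x (complex_poly R)) * real (order y (f x)) * ln (cmod (eval2 (G (i (x, y))) x y)) \<le>
          real (order x (complex_poly R)) * real (order y (f x)) * U x y"
      using ln_eval2_le[OF G] i unfolding U_def by (intro mult_left_mono) auto
  qed
  also have "\<dots> \<le> (\<Sum>(x, y)\<in>zeros R F. real (order x (complex_poly R)) * real (order y (f x)) * U x y)"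
    using fin A U_nonneg by (intro sum_mono2) auto
  also have "\<dots> \<le> 5 * (B * L)" unfolding sum_zeros by (rule sum_U_le)
  finally show ?thesis .
qed

text \<open>
  An upper bound \<open>U \<ge> 0\<close> of \<open>t\<close> gives \<open>\<bar>t\<bar> \<le> 2 U - t\<close>, which leaves the lower bound for the sum of
  the logarithms themselves.
\<close>

theorem sum_abs_ln_le:
  fixes G :: "nat \<Rightarrow> int poly poly"
  assumes G: "\<And>l. l \<in> {1..m} \<Longrightarrow> magnitude2 (complex_poly2 (G l)) n2 \<tau>2"
    and i: "\<And>x y. (x, y) \<in> zeros R F \<Longrightarrow>
              i (x, y) \<in> {1..m} \<and> eval2 (complex_poly2 (G (i (x, y)))) x y \<noteq> 0 \<and>
              (\<forall>k\<in>{1..m}. k < i (x, y) \<longrightarrow> eval2 (complex_poly2 (G k)) x y = 0)"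
  shows "(\<Sum>(x, y)\<in>zeros R F. real (order x (complex_poly R)) * real (order y (f x)) *
            \<bar>ln (cmod (eval2 (complex_poly2 (G (i (x, y)))) x y))\<bar>) \<le> 17 * (B * L)"
proof -
  define g where "g x y = cmod (eval2 (complex_poly2 (G (i (x, y)))) x y)" for x y
  have ln_g: "\<bar>ln (g x y)\<bar> \<le> 2 * U x y - ln (g x y)" if "(x, y) \<in> zeros R F" for x y
    using ln_eval2_le[OF G, of "i (x, y)" x y] i[OF that] U_nonneg[of x y] by (simp add: U_def g_def)
  have "(\<Sum>(x, y)\<in>zeros R F. real (order x (complex_poly R)) * real (order y (f x)) * \<bar>ln (g x y)\<bar>) =
    (\<Sum>x\<leftarrow>xs. \<Sum>y\<leftarrow>ys x. \<bar>ln (g x y)\<bar>)"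
    by (rule sum_zeros)
  also have "\<dots> \<le> (\<Sum>x\<leftarrow>xs. \<Sum>y\<leftarrow>ys x. 2 * U x y - ln (g x y))"
    using ln_g set_xs set_ys by (intro sum_list_double_mono) (auto simp: zeros_def eval2_def)
  also have "\<dots> = 2 * (\<Sum>x\<leftarrow>xs. \<Sum>y\<leftarrow>ys x. U x y) - (\<Sum>x\<leftarrow>xs. \<Sum>y\<leftarrow>ys x. ln (g x y))"
    by (simp only: sum_list_subtractf sum_list_const_mult)
  also have "\<dots> \<le> 10 * (B * L) + (real (n1 + 2 * n1 * n2) * real \<Lambda> +
      (real n2 + 1) * (N * (2 * L + \<tau>1) + n1 * (L + \<Lambda>)))"
    using sum_U_le sum_ln_values_ge[OF G i] by (simp add: g_def)
  also have "\<dots> \<le> 10 * (B * L) + (real (3 * n1 * n2) * (L * real \<Lambda>) +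
      (2 * real n2) * (N * (3 * (L * \<tau>1)) + n1 * (2 * (L * \<Lambda>))))"
  proof -
    have "n1 * 1 \<le> n1 * n2" using pos by (intro mult_le_mono) auto
    hence "n1 + 2 * n1 * n2 \<le> 3 * n1 * n2" by simp
    hence "real (n1 + 2 * n1 * n2) \<le> real (3 * n1 * n2)" by (simp only: of_nat_le_iff)
    moreover have "real \<Lambda> \<le> L * real \<Lambda>" using mult_right_mono[of 1 L "real \<Lambda>"] L by simp
    ultimately show ?thesis
      using log_absorb[of \<tau>1 2 1] log_absorb[of \<Lambda> 1 1] pos L
      by (intro add_mono mult_mono mult_left_mono order.refl) auto
  qed
  also have "\<dots> = 10 * (B * L) + 6 * (real (\<tau>1 * n2 * N) * L) + 7 * (real (\<Lambda> * n1 * n2) * L)"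
    by (simp add: algebra_simps)
  also have "\<dots> \<le> 10 * (B * L) + 7 * (real (\<tau>1 * n2 * N) * L) + 7 * (real (\<Lambda> * n1 * n2) * L) +
      7 * (real (\<tau>2 * n1 * N) * L) + 7 * (real (N * n1 * n2) * L)"
    using L by simp
  also have "\<dots> = 17 * (B * L)" by (simp add: B_def algebra_simps)
  finally show ?thesis by (simp add: g_def)
qed

end

end

section \<open>Amortised bounds for values at the zeros\<close>

lemma one_le_ln: "3 \<le> x \<Longrightarrow> 1 \<le> ln (x :: real)"
  using exp_le by (subst ln_ge_iff) linarith+

lemma eq_Least_imp:
  fixes i :: nat
  assumes "i = (LEAST l. P l)" "\<exists>l. P l"
  shows "P i" "k < i \<Longrightarrow> \<not> P k"
  using assms by (auto intro: LeastI_ex dest: not_less_Least)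

theorem proposition14:
  shows
    "(\<exists>(C::real) (k::nat). C > 0 \<and>
       (\<forall>(N::nat) (\<Lambda>::nat) (n1::nat) (\<tau>1::nat) (n2::nat) (\<tau>2::nat) (m::nat)
          (R::int poly) (F::int poly poly) (G::nat \<Rightarrow> complex poly poly)
          (A::(complex \<times> complex) set) (i::complex \<times> complex \<Rightarrow> nat).
          N > 0 \<and> \<Lambda> > 0 \<and> n1 > 0 \<and> \<tau>1 > 0 \<and> n2 > 0 \<and> \<tau>2 > 0 \<longrightarrow>
          R \<noteq> 0 \<longrightarrow> magnitude (complex_poly R) N \<Lambda> \<longrightarrow>
          magnitude2 (complex_poly2 F) n1 \<tau>1 \<longrightarrow>
          finite (zeros R F) \<longrightarrow>
          (\<forall>l\<in>{1..m}. magnitude2 (G l) n2 \<tau>2) \<longrightarrow>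
          A \<subseteq> zeros R F \<longrightarrow>
          (\<forall>(x, y)\<in>A. i (x, y) \<in> {1..m} \<and> eval2 (G (i (x, y))) x y \<noteq> 0) \<longrightarrow>
          (\<Sum>(x, y)\<in>A. real (order x (complex_poly R)) *
                      real (order y (spec_X (complex_poly2 F) x)) *
                      ln (cmod (eval2 (G (i (x, y))) x y)))
            \<le> soft_bound C k [N, \<Lambda>, n1, \<tau>1, n2, \<tau>2]
                (real ((\<tau>2 * n1 + \<tau>1 * n2) * N + (\<Lambda> + N) * n1 * n2))))
     \<and>
     (\<exists>(C::real) (k::nat). C > 0 \<and>
       (\<forall>(N::nat) (\<Lambda>::nat) (n1::nat) (\<tau>1::nat) (n2::nat) (\<tau>2::nat) (m::nat)
          (R::int poly) (F::int poly poly) (G::nat \<Rightarrow> int poly poly)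
          (i::complex \<times> complex \<Rightarrow> nat).
          N > 0 \<and> \<Lambda> > 0 \<and> n1 > 0 \<and> \<tau>1 > 0 \<and> n2 > 0 \<and> \<tau>2 > 0 \<longrightarrow>
          R \<noteq> 0 \<longrightarrow> magnitude (complex_poly R) N \<Lambda> \<longrightarrow>
          magnitude2 (complex_poly2 F) n1 \<tau>1 \<longrightarrow>
          finite (zeros R F) \<longrightarrow>
          (\<forall>l\<in>{1..m}. magnitude2 (complex_poly2 (G l)) n2 \<tau>2) \<longrightarrow>
          (\<forall>(x, y)\<in>zeros R F. \<exists>l\<in>{1..m}. eval2 (complex_poly2 (G l)) x y \<noteq> 0) \<longrightarrow>
          (\<forall>(x, y)\<in>zeros R F. i (x, y) =
             (LEAST l. l \<in> {1..m} \<and> eval2 (complex_poly2 (G l)) x y \<noteq> 0)) \<longrightarrow>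
          (\<Sum>(x, y)\<in>zeros R F. real (order x (complex_poly R)) *
                      real (order y (spec_X (complex_poly2 F) x)) *
                      \<bar>ln (cmod (eval2 (complex_poly2 (G (i (x, y)))) x y))\<bar>)
            \<le> soft_bound C k [N, \<Lambda>, n1, \<tau>1, n2, \<tau>2]
                (real ((\<tau>2 * n1 + \<tau>1 * n2) * N + (\<Lambda> + N) * n1 * n2))))"
proof -
  have system: "zero_dimensional_system R F N \<Lambda> n1 \<tau>1 (ln (2 + real (sum_list [N, \<Lambda>, n1, \<tau>1, n2, \<tau>2])))"
    if "N > 0 \<and> \<Lambda> > 0 \<and> n1 > 0 \<and> \<tau>1 > 0 \<and> n2 > 0 \<and> \<tau>2 > 0" "R \<noteq> 0" "magnitude (complex_poly R) N \<Lambda>"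
      "magnitude2 (complex_poly2 F) n1 \<tau>1" "finite (zeros R F)" for R F N \<Lambda> n1 \<tau>1 n2 \<tau>2
    using that by unfold_locales (auto intro!: one_le_ln)
  have ln_n2: "ln (real n2 + 1) \<le> ln (2 + real (sum_list [N, \<Lambda>, n1, \<tau>1, n2, \<tau>2]))" for N \<Lambda> n1 \<tau>1 n2 \<tau>2
    by simp
  show ?thesis
  proof (rule conjI, goal_cases)
    case 1
    show ?case
    proof (rule exI[of _ 5], rule exI[of _ 1], intro conjI allI impI, goal_cases)
      case (2 N \<Lambda> n1 \<tau>1 n2 \<tau>2 m R F G A i)
      from 2(1-5) interpret zero_dimensional_system R F N \<Lambda> n1 \<tau>1 "ln (2 + real (sum_list [N, \<Lambda>, n1, \<tau>1, n2, \<tau>2]))"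
        by (intro system)
      show ?case
        unfolding soft_bound_def power_one_right mult.assoc[of 5]
      proof (rule sum_ln_le[OF _ _ _ _ ln_n2])
        show "magnitude2 (G l) n2 \<tau>2" if "l \<in> {1..m}" for l using 2(6) that by blast
        show "i (x, y) \<in> {1..m} \<and> eval2 (G (i (x, y))) x y \<noteq> 0" if "(x, y) \<in> A" for x y
          using bspec[OF 2(8) that] by (simp only: prod.case simp_thms)
        show "A \<subseteq> zeros R F" by (rule 2(7))
      qed (use 2(1) in simp_all)
    qed simp
  next
    case 2
    show ?case
    proof (rule exI[of _ 17], rule exI[of _ 1], intro conjI allI impI, goal_cases)
      case (2 N \<Lambda> n1 \<tau>1 n2 \<tau>2 m R F G i)
      from 2(1-5) interpret zero_dimensional_system R F N \<Lambda> n1 \<tau>1 "ln (2 + real (sum_list [N, \<Lambda>, n1, \<tau>1, n2, \<tau>2]))"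
        by (intro system)
      have least: "i (x, y) \<in> {1..m} \<and> eval2 (complex_poly2 (G (i (x, y)))) x y \<noteq> 0 \<and>
          (\<forall>k\<in>{1..m}. k < i (x, y) \<longrightarrow> eval2 (complex_poly2 (G k)) x y = 0)"
        if xy: "(x, y) \<in> zeros R F" for x y
      proof -
        let ?P = "\<lambda>l. l \<in> {1..m} \<and> eval2 (complex_poly2 (G l)) x y \<noteq> 0"
        have "i (x, y) = (LEAST l. ?P l)" using bspec[OF 2(8) xy] by (simp only: prod.case)
        moreover have "\<exists>l. ?P l" using bspec[OF 2(7) xy] by (simp only: prod.case Bex_def)
        ultimately have "?P (i (x, y))" "\<And>k. k < i (x, y) \<Longrightarrow> \<not> ?P k"
          by (rule eq_Least_imp)+
        thus ?thesis by blast
      qed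
      show ?case
        unfolding soft_bound_def power_one_right mult.assoc[of 17]
      proof (rule sum_abs_ln_le[OF _ _ _ _ ln_n2 _ least])
        show "magnitude2 (complex_poly2 (G l)) n2 \<tau>2" if "l \<in> {1..m}" for l using 2(6) that by blast
      qed (use 2(1) in simp_all)
    qed simp
  qed
qed

end
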